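(* Let $E$ be an arbitrary subset of a separable Banach space $X$, let $f: E \to \mathbb{R}$ be a function and let $G: E \rightrightarrows X^*$ be a set-valued mapping such that $G(x)$ is a nonempty convex $w^*$-compact subset of $X^{*}$ for every $x\in E$. There exists a convex function $F: X \to \mathbb{R}$, bounded on bounded subsets of $X$ and such that $F(x)=f(x)$ and $\partial F(x)= G(x)$ for every $x\in E$, if and only if the following three conditions are all satisfied. $(C)$: $f(x) \geq f(y)+ y^* (x-y)$ for every $x,y\in E$ and every $y^*\in G(y)$. $(EX)$: If $(y_k)_k \subset E$ and $(y_k^* )_k \subset X^*$ are sequences such that $y_k^* \in G(y_k)$ for every $k$ and $\lim_k \|y_k^*\|_* =+\infty$, then $$\lim_k \frac{ y_k^*(y_k)-f(y_k)}{\|y_k^*\|_*}= +\infty.$$ $(SCS)$: If $x\in E$ and $(y_k)_k \subset E$, $(y_k^* )_k \subset X^*$ are sequences such that $y_k^* \in G(y_k)$ for every $k$, $(y_k^* )_k$ is bounded, and $$\lim_k \left( f(x)-f(y_k)-y_k^* (x-y_k ) \right)=0,$$ then there exists a sequence $(x_k^* )_k \subset G(x)$ such that $w^*\text{-}\lim_k (y_k^*-x_k^* )=0$.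
   Context: Banach spaces are real. $(X,\|\cdot\|)$ is a Banach space, $X^*$ its topological dual with dual norm $\|\cdot\|_*$, and $w^*$ denotes the weak-star topology on $X^*$. A set-valued mapping $G: E \rightrightarrows X^*$ assigns to each $x\in E$ a subset $G(x)\subset X^*$. For a convex function $F:X\to\mathbb{R}$, the subdifferential at $x$ is $\partial F(x)=\{\xi\in X^* : F(z)\ge F(x)+ \xi(z-x) \text{ for all } z\in X\}$. *)

theory Defs
  imports "HOL-Analysis.Analysis"
begin

text \<open>The topological dual, carrying the operator norm as dual norm.\<close>

type_synonym 'a dual = "'a \<Rightarrow>\<^sub>L real"

text \<open>For scalar-valued operators, the strong operator topology (pointwise convergence on the
  whole space) is the weak-star topology of the dual.\<close>

abbreviation weak_star :: "'a::real_normed_vector dual topology" where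
  "weak_star \<equiv> strong_operator_topology"

definition subdifferential :: "('a::real_normed_vector \<Rightarrow> real) \<Rightarrow> 'a \<Rightarrow> 'a dual set" where
  "subdifferential F x = {\<xi>. \<forall>z. F z \<ge> F x + blinfun_apply \<xi> (z - x)}"

text \<open>In the following conditions only the values of \<open>f\<close> and \<open>G\<close> on \<open>E\<close> matter.\<close>

definition condition_C ::
    "'a::real_normed_vector set \<Rightarrow> ('a \<Rightarrow> real) \<Rightarrow> ('a \<Rightarrow> 'a dual set) \<Rightarrow> bool" where
  "condition_C E f G \<longleftrightarrow>
    (\<forall>x\<in>E. \<forall>y\<in>E. \<forall>\<eta>\<in>G y. f x \<ge> f y + blinfun_apply \<eta> (x - y))"

definition condition_EX ::
    "'a::real_normed_vector set \<Rightarrow> ('a \<Rightarrow> real) \<Rightarrow> ('a \<Rightarrow> 'a dual set) \<Rightarrow> bool" where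
  "condition_EX E f G \<longleftrightarrow>
    (\<forall>(y :: nat \<Rightarrow> 'a) (\<eta> :: nat \<Rightarrow> 'a dual).
      (\<forall>k. y k \<in> E) \<and> (\<forall>k. \<eta> k \<in> G (y k)) \<and>
      filterlim (\<lambda>k. norm (\<eta> k)) at_top sequentially \<longrightarrow>
      filterlim (\<lambda>k. (blinfun_apply (\<eta> k) (y k) - f (y k)) / norm (\<eta> k)) at_top sequentially)"

definition condition_SCS ::
    "'a::real_normed_vector set \<Rightarrow> ('a \<Rightarrow> real) \<Rightarrow> ('a \<Rightarrow> 'a dual set) \<Rightarrow> bool" where
  "condition_SCS E f G \<longleftrightarrow>
    (\<forall>x\<in>E. \<forall>(y :: nat \<Rightarrow> 'a) (\<eta> :: nat \<Rightarrow> 'a dual).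
      (\<forall>k. y k \<in> E) \<and> (\<forall>k. \<eta> k \<in> G (y k)) \<and> bounded (range \<eta>) \<and>
      (\<lambda>k. f x - f (y k) - blinfun_apply (\<eta> k) (x - y k)) \<longlonglongrightarrow> 0 \<longrightarrow>
      (\<exists>\<xi> :: nat \<Rightarrow> 'a dual.
        (\<forall>k. \<xi> k \<in> G x) \<and> limitin weak_star (\<lambda>k. \<eta> k - \<xi> k) 0 sequentially))"

end

theory Submission
  imports Defs "HOL-Complex_Analysis.Great_Picard"
begin

text \<open>For sufficiency the extension is the supremum \<open>m\<close> of the prescribed affine minorants
  \<open>z \<mapsto> f y + \<eta> (z - y)\<close>. By \<open>(EX)\<close>, minorants that are not very negative somewhere on a given ball
  have bounded slopes, so \<open>m\<close> is bounded on bounded sets. If \<open>\<xi> \<in> \<partial>m(x)\<close> were outside \<open>G x\<close>,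
  it would be separated from \<open>G x\<close> by some \<open>v \<in> X\<close>; minorants that nearly attain \<open>m(x + t v)\<close>
  (up to \<open>t\<^sup>2\<close>) nearly attain \<open>f x\<close> at \<open>x\<close> and have slope almost \<open>\<xi> v\<close> or more along \<open>v\<close>,
  so \<open>(SCS)\<close> yields elements of \<open>G x\<close> contradicting the separation.
  For necessity, only \<open>(SCS)\<close> needs separability: bounded sequences in the dual then have weak-star
  convergent subsequences, and weak-star limits of \<open>\<epsilon>\<^sub>k\<close>-subgradients at \<open>x\<close>, \<open>\<epsilon>\<^sub>k \<rightarrow> 0\<close>,
  are subgradients.\<close>

section \<open>Weak-star convergence and separation of a point from a convex weak-star compact
  set\<close>

text \<open>The topology is pulled back from the product topology on functions, where convergence is
  componentwise.\<close>

lemma limitin_weak_star_iff: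
  "limitin weak_star f l F \<longleftrightarrow> (\<forall>x. ((\<lambda>k. blinfun_apply (f k) x) \<longlongrightarrow> blinfun_apply l x) F)"
proof -
  have "limitin weak_star f l F \<longleftrightarrow> limitin euclidean (\<lambda>k. blinfun_apply (f k)) (blinfun_apply l) F"
    unfolding limitin_def strong_operator_topology_topspace topspace_euclidean
    unfolding strong_operator_topology_def openin_pullback_topology by auto
  also have "\<dots> \<longleftrightarrow> (\<forall>x. ((\<lambda>k. blinfun_apply (f k) x) \<longlongrightarrow> blinfun_apply l x) F)"
    unfolding euclidean_product_topology[symmetric] limitin_componentwise by simp
  finally show ?thesis .
qed

text \<open>First-order optimality at the left end of a segment: for small \<open>t\<close> the
  linear term dominates the quadratic one.\<close>

lemma nonneg_of_quadratic_nonneg: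
  fixes A B :: real
  assumes "B \<ge> 0" and nn: "\<And>t. 0 < t \<Longrightarrow> t \<le> 1 \<Longrightarrow> 0 \<le> 2 * t * A + t\<^sup>2 * B"
  shows "A \<ge> 0"
proof (rule ccontr)
  assume "\<not> A \<ge> 0"
  then have A: "A < 0" by simp
  \<comment> \<open>With \<open>A < 0\<close> this choice gives \<open>t * B < - 2 * A\<close>. The
    \<open>+ 1\<close> avoids division by zero when \<open>B = 0\<close>.\<close>
  define t where "t = min 1 (- A / (B + 1))"
  have t: "0 < t" "t \<le> 1" using A \<open>B \<ge> 0\<close> by (auto simp: t_def intro!: divide_neg_pos)
  have "t \<le> - A / (B + 1)" by (simp add: t_def)
  then have "t * (B + 1) \<le> - A" using \<open>B \<ge> 0\<close> by (subst (asm) pos_le_divide_eq) auto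
  then have "t * B < - 2 * A" using t A by (simp add: algebra_simps)
  then have "t * (t * B) < t * (- 2 * A)" using t(1) by (rule mult_strict_left_mono)
  with nn[OF t] show False by (simp add: power2_eq_square algebra_simps)
qed

text \<open>Compactness reduces the separation to finitely many evaluations \<open>\<eta> \<mapsto> \<eta> v\<close>, \<open>v \<in> I\<close>; there the
  separating vector points from the nearest point of \<open>K\<close> to \<open>\<xi>\<close>.\<close>

lemma weak_star_separation:
  fixes K :: "'a::real_normed_vector dual set"
  assumes K: "compactin weak_star K" "convex K" "K \<noteq> {}" and "\<xi> \<notin> K"
  obtains v d where "d > 0" "\<And>\<eta>. \<eta> \<in> K \<Longrightarrow> blinfun_apply \<eta> v + d \<le> blinfun_apply \<xi> v"
proof -
  define U where "U v = {\<eta> :: 'a dual. blinfun_apply \<eta> v \<noteq> blinfun_apply \<xi> v}" for v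
  have "openin weak_star (U v)" for v
  proof -
    have "openin weak_star {\<eta> \<in> topspace weak_star. blinfun_apply \<eta> v \<in> - {blinfun_apply \<xi> v}}"
      by (rule openin_continuous_map_preimage[OF strong_operator_topology_continuous_evaluation]) auto
    then show ?thesis by (simp add: U_def strong_operator_topology_topspace)
  qed
  moreover have "K \<subseteq> \<Union> (range U)"
  proof
    fix \<eta> assume "\<eta> \<in> K"
    then have "\<eta> \<noteq> \<xi>" using \<open>\<xi> \<notin> K\<close> by auto
    then show "\<eta> \<in> \<Union> (range U)" by (auto simp: U_def intro: blinfun_eqI)
  qed
  ultimately obtain \<F> where "finite \<F>" "\<F> \<subseteq> range U" "K \<subseteq> \<Union> \<F>"
    using K(1) unfolding compactin_def by (metis (no_types, lifting) rangeE)
  then obtain I where I: "finite I" "K \<subseteq> \<Union> (U ` I)"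
    by (metis finite_subset_image)
  \<comment> \<open>The squared Euclidean distance from \<open>\<xi>\<close> after evaluation on
    \<open>I\<close>. It is positive on \<open>K\<close>, because every element of \<open>K\<close>
    differs from \<open>\<xi>\<close> at some vector of \<open>I\<close>.\<close>
  define g where "g \<eta> = (\<Sum>v\<in>I. (blinfun_apply \<eta> v - blinfun_apply \<xi> v)\<^sup>2)" for \<eta>
  have "continuous_map weak_star euclideanreal g"
    unfolding g_def using I(1)
    by (intro continuous_map_sum continuous_map_real_pow continuous_map_diff
        strong_operator_topology_continuous_evaluation) auto
  then have "compact (g ` K)" using image_compactin[OF K(1)] by fastforce
  then obtain \<eta>\<^sub>0 where \<eta>\<^sub>0: "\<eta>\<^sub>0 \<in> K" and min: "\<And>\<eta>. \<eta> \<in> K \<Longrightarrow> g \<eta>\<^sub>0 \<le> g \<eta>"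
    using compact_attains_inf[of "g ` K"] K(3) by auto
  define c where "c v = blinfun_apply \<eta>\<^sub>0 v - blinfun_apply \<xi> v" for v
  have g0: "g \<eta>\<^sub>0 = (\<Sum>v\<in>I. (c v)\<^sup>2)" by (simp add: g_def c_def)
  obtain v\<^sub>0 where "v\<^sub>0 \<in> I" "c v\<^sub>0 \<noteq> 0"
    using I(2) \<eta>\<^sub>0 by (auto simp: U_def c_def)
  then have pos: "g \<eta>\<^sub>0 > 0"
    unfolding g0 using I(1) by (intro sum_pos2[of I v\<^sub>0]) auto
  \<comment> \<open>Minus the inner product with \<open>c\<close> of the evaluations on
    \<open>I\<close> is itself an evaluation, namely at \<open>w\<close>; so the finite-dimensional
    separating functional comes from a vector of the space.\<close>
  define w where "w = - (\<Sum>v\<in>I. c v *\<^sub>R v)"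
  have app_w: "blinfun_apply \<eta> w = - (\<Sum>v\<in>I. c v * blinfun_apply \<eta> v)" for \<eta> :: "'a dual"
    by (simp add: w_def blinfun.minus_right blinfun.sum_right blinfun.scaleR_right)
  have "blinfun_apply \<eta> w + g \<eta>\<^sub>0 \<le> blinfun_apply \<xi> w" if "\<eta> \<in> K" for \<eta>
  proof -
    define e where "e v = blinfun_apply \<eta> v - blinfun_apply \<eta>\<^sub>0 v" for v
    \<comment> \<open>Optimality of \<open>\<eta>\<^sub>0\<close> along the segment to
      \<open>\<eta>\<close>, which stays in \<open>K\<close> by convexity.\<close>
    have "0 \<le> (\<Sum>v\<in>I. c v * e v)"
    proof (rule nonneg_of_quadratic_nonneg[where B = "\<Sum>v\<in>I. (e v)\<^sup>2"])
      show "0 \<le> (\<Sum>v\<in>I. (e v)\<^sup>2)" by (simp add: sum_nonneg)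
      fix t :: real assume t: "0 < t" "t \<le> 1"
      have "(1 - t) *\<^sub>R \<eta>\<^sub>0 + t *\<^sub>R \<eta> \<in> K"
        using t by (intro convexD_alt[OF K(2) \<eta>\<^sub>0 that]) auto
      from min[OF this] have "g \<eta>\<^sub>0 \<le> (\<Sum>v\<in>I. (c v + t * e v)\<^sup>2)"
        by (simp add: g_def c_def e_def blinfun.add_left blinfun.scaleR_left)
          (simp add: algebra_simps)
      also have "\<dots> = g \<eta>\<^sub>0 + (2 * t * (\<Sum>v\<in>I. c v * e v) + t\<^sup>2 * (\<Sum>v\<in>I. (e v)\<^sup>2))"
        unfolding g0 sum_distrib_left sum.distrib[symmetric]
        by (intro sum.cong refl) (simp add: power2_eq_square algebra_simps)
      finally show "0 \<le> 2 * t * (\<Sum>v\<in>I. c v * e v) + t\<^sup>2 * (\<Sum>v\<in>I. (e v)\<^sup>2)" by simp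
    qed
    moreover have "blinfun_apply \<xi> w - blinfun_apply \<eta> w = (\<Sum>v\<in>I. c v * e v) + g \<eta>\<^sub>0"
      unfolding app_w g0 sum.distrib[symmetric] minus_diff_minus sum_subtractf[symmetric]
        sum_negf[symmetric]
      by (intro sum.cong refl) (simp add: c_def e_def power2_eq_square algebra_simps)
    ultimately show ?thesis by linarith
  qed
  with pos that show thesis by blast
qed

section \<open>Weak-star sequential compactness of bounded sets in the dual\<close>

text \<open>The functionals share the Lipschitz constant \<open>M\<close>, so the Cauchy property
  spreads from \<open>D\<close> to its closure. The pointwise limit inherits linearity and the bound
  \<open>M\<close>.\<close>

lemma bounded_dual_tendsto_dense:
  fixes \<eta> :: "nat \<Rightarrow> 'a::real_normed_vector dual"
  assumes D: "closure D = UNIV" and M: "\<And>k. norm (\<eta> k) \<le> M"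
    and conv: "\<And>x. x \<in> D \<Longrightarrow> convergent (\<lambda>k. blinfun_apply (\<eta> k) x)"
  obtains \<xi> where "\<And>x. (\<lambda>k. blinfun_apply (\<eta> k) x) \<longlonglongrightarrow> blinfun_apply \<xi> x"
proof -
  have M0: "0 \<le> M" using norm_ge_zero M by (rule order_trans)
  have bd: "\<bar>blinfun_apply (\<eta> k) z\<bar> \<le> M * norm z" for k z
    using norm_blinfun[of "\<eta> k" z] mult_right_mono[OF M[of k] norm_ge_zero[of z]] by simp
  have "convergent (\<lambda>k. blinfun_apply (\<eta> k) x)" for x
  proof (intro Cauchy_convergent CauchyI)
    fix e :: real assume "e > 0"
    define r where "r = e / 4 / (M + 1)"
    have "r > 0" using \<open>e > 0\<close> M0 by (simp add: r_def)
    then obtain y where y: "y \<in> D" "dist y x < r"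
      using closure_approachable[of x D] D by auto
    have "Cauchy (\<lambda>k. blinfun_apply (\<eta> k) y)"
      using conv[OF y(1)] by (rule convergent_Cauchy)
    then obtain N where N: "\<And>m n. m \<ge> N \<Longrightarrow> n \<ge> N \<Longrightarrow>
        norm (blinfun_apply (\<eta> m) y - blinfun_apply (\<eta> n) y) < e / 2"
      using CauchyD[of _ "e / 2"] \<open>e > 0\<close> by (metis half_gt_zero)
    have near: "\<bar>blinfun_apply (\<eta> k) x - blinfun_apply (\<eta> k) y\<bar> \<le> e / 4" for k
    proof -
      have "\<bar>blinfun_apply (\<eta> k) x - blinfun_apply (\<eta> k) y\<bar> \<le> M * norm (x - y)"
        using bd[of k "x - y"] by (simp add: blinfun.diff_right)
      also have "\<dots> \<le> (M + 1) * r"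
        using y(2) M0 by (intro mult_mono) (auto simp: dist_norm norm_minus_commute)
      also have "\<dots> = e / 4" using M0 by (simp add: r_def del: divide_divide_eq_left)
      finally show ?thesis .
    qed
    show "\<exists>N. \<forall>m\<ge>N. \<forall>n\<ge>N. norm (blinfun_apply (\<eta> m) x - blinfun_apply (\<eta> n) x) < e"
    proof (intro exI allI impI)
      fix m n assume "m \<ge> N" "n \<ge> N"
      from N[OF this] near[of m] near[of n]
      show "norm (blinfun_apply (\<eta> m) x - blinfun_apply (\<eta> n) x) < e"
        unfolding real_norm_def by linarith
    qed
  qed
  then obtain l where l: "\<And>x. (\<lambda>k. blinfun_apply (\<eta> k) x) \<longlonglongrightarrow> l x"
    unfolding convergent_def by metis
  have "bounded_linear l"
  proof (rule bounded_linear_intro)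
    show "l (x + y) = l x + l y" for x y
      using tendsto_add[OF l[of x] l[of y]] l[of "x + y"]
      by (intro LIMSEQ_unique[of "\<lambda>k. blinfun_apply (\<eta> k) (x + y)"]) (auto simp: blinfun.add_right)
    show "l (r *\<^sub>R x) = r *\<^sub>R l x" for r x
      using tendsto_scaleR[OF tendsto_const[of r] l[of x]] l[of "r *\<^sub>R x"]
      by (intro LIMSEQ_unique[of "\<lambda>k. blinfun_apply (\<eta> k) (r *\<^sub>R x)"]) (auto simp: blinfun.scaleR_right)
    show "norm (l x) \<le> norm x * M" for x
      using bd[of _ x] by (intro Lim_norm_ubound[OF _ l]) (auto simp: mult.commute)
  qed
  then have "blinfun_apply (Blinfun l) = l" by (rule bounded_linear_Blinfun_apply)
  with l show thesis by (intro that[of "Blinfun l"]) simp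
qed

text \<open>Sequential Banach-Alaoglu: a subsequence convergent at every point of the countable set
  \<open>D\<close> converges everywhere by density.\<close>

lemma bounded_dual_convergent_subsequence:
  fixes \<eta> :: "nat \<Rightarrow> 'a::real_normed_vector dual" and D :: "'a set"
  assumes D: "countable D" "closure D = UNIV" and M: "\<And>k. norm (\<eta> k) \<le> M"
  obtains r \<xi> where "strict_mono (r :: nat \<Rightarrow> nat)"
    "\<And>x. (\<lambda>k. blinfun_apply (\<eta> (r k)) x) \<longlonglongrightarrow> blinfun_apply \<xi> x"
proof -
  have M0: "0 \<le> M" using norm_ge_zero M by (rule order_trans)
  \<comment> \<open>The selection of a subsequence asks for one bound valid at all points, hence the
    normalization by \<open>1 + norm x\<close>, which is undone afterwards.\<close>
  have "norm (blinfun_apply (\<eta> k) x / (1 + norm x)) \<le> M" for k x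
  proof -
    have "\<bar>blinfun_apply (\<eta> k) x\<bar> \<le> M * norm x"
      using norm_blinfun[of "\<eta> k" x] mult_right_mono[OF M[of k] norm_ge_zero[of x]] by simp
    also have "\<dots> \<le> M * (1 + norm x)" using M0 by (intro mult_left_mono) auto
    finally show ?thesis by (simp add: divide_le_eq abs_of_pos add_pos_nonneg)
  qed
  then obtain r :: "nat \<Rightarrow> nat" where r: "strict_mono r"
    and conv: "\<And>x. x \<in> D \<Longrightarrow> \<exists>l. (\<lambda>k. blinfun_apply (\<eta> (r k)) x / (1 + norm x)) \<longlonglongrightarrow> l"
    using function_convergent_subsequence[OF D(1), of "\<lambda>k x. blinfun_apply (\<eta> k) x / (1 + norm x)" M]
    by metis
  have "convergent (\<lambda>k. blinfun_apply (\<eta> (r k)) x)" if x: "x \<in> D" for x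
  proof -
    obtain l where "(\<lambda>k. blinfun_apply (\<eta> (r k)) x / (1 + norm x)) \<longlonglongrightarrow> l"
      using conv[OF x] by blast
    from tendsto_mult[OF this tendsto_const[of "1 + norm x"]]
    have "(\<lambda>k. blinfun_apply (\<eta> (r k)) x) \<longlonglongrightarrow> l * (1 + norm x)"
      using norm_ge_zero[of x] by (simp add: add_nonneg_eq_0_iff)
    then show ?thesis by (rule convergentI)
  qed
  then obtain \<xi> where "\<And>x. (\<lambda>k. blinfun_apply (\<eta> (r k)) x) \<longlonglongrightarrow> blinfun_apply \<xi> x"
    using bounded_dual_tendsto_dense[OF D(2), of "\<lambda>k. \<eta> (r k)" M] M by blast
  with r that show thesis by blast
qed

section \<open>Necessity: consequences of boundedness on bounded sets\<close>

text \<open>A one-sided bound suffices because the ball is symmetric. This turns upper bounds of a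
  function on balls into norm bounds for its subgradients.\<close>

lemma norm_dual_le_of_ball_bound:
  fixes \<eta> :: "'a::real_normed_vector dual"
  assumes "R > 0" and le: "\<And>z. norm z \<le> R \<Longrightarrow> blinfun_apply \<eta> z \<le> C"
  shows "R * norm \<eta> \<le> C"
proof -
  have "0 \<le> C" using le[of 0] \<open>R > 0\<close> by simp
  have "blinfun_apply \<eta> z \<le> C / R * norm z" for z
  proof (cases "z = 0")
    case False
    have "blinfun_apply \<eta> ((R / norm z) *\<^sub>R z) \<le> C"
      using False \<open>R > 0\<close> by (intro le) simp
    then show ?thesis using False \<open>R > 0\<close> by (simp add: blinfun.scaleR_right field_simps)
  qed simp
  from this this[of "- _"] have "norm (blinfun_apply \<eta> z) \<le> C / R * norm z" for z
    by (simp add: blinfun.minus_right abs_le_iff)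
  then have "norm \<eta> \<le> C / R"
    using \<open>0 \<le> C\<close> \<open>R > 0\<close> by (intro norm_blinfun_bound) auto
  then show ?thesis using \<open>R > 0\<close> by (simp add: field_simps)
qed

lemma bounded_image_cball_obtain:
  fixes F :: "'a::real_normed_vector \<Rightarrow> real"
  assumes "\<forall>B. bounded B \<longrightarrow> bounded (F ` B)"
  obtains C where "\<And>z. norm z \<le> R \<Longrightarrow> \<bar>F z\<bar> \<le> C"
proof -
  have "bounded (F ` cball 0 R)" using assms by simp
  then show thesis using that by (force simp: bounded_iff)
qed

text \<open>Testing the subgradient inequality on the ball of radius \<open>R\<close>, where
  \<open>F\<close> is at most \<open>C\<close>, shows that the quotient is at least
  \<open>R - C / norm (\<eta> k)\<close>, and \<open>R\<close> is arbitrary.\<close>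

lemma condition_EX_of_subdifferential:
  fixes F :: "'a::real_normed_vector \<Rightarrow> real"
  assumes bdd: "\<forall>B. bounded B \<longrightarrow> bounded (F ` B)"
    and F: "\<And>x. x \<in> E \<Longrightarrow> F x = f x" and G: "\<And>x. x \<in> E \<Longrightarrow> G x \<subseteq> subdifferential F x"
  shows "condition_EX E f G"
  unfolding condition_EX_def
proof (intro allI impI, elim conjE)
  fix y :: "nat \<Rightarrow> 'a" and \<eta> :: "nat \<Rightarrow> 'a dual"
  assume y: "\<forall>k. y k \<in> E" and \<eta>: "\<forall>k. \<eta> k \<in> G (y k)"
    and lim: "filterlim (\<lambda>k. norm (\<eta> k)) at_top sequentially"
  show "filterlim (\<lambda>k. (blinfun_apply (\<eta> k) (y k) - f (y k)) / norm (\<eta> k)) at_top sequentially"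
    unfolding filterlim_at_top
  proof
    fix Z :: real
    \<comment> \<open>The extra \<open>1\<close> absorbs the error
      \<open>C / norm (\<eta> k)\<close> once the norm exceeds \<open>\<bar>C\<bar>\<close>.\<close>
    define R where "R = \<bar>Z\<bar> + 1"
    have "R > 0" by (simp add: R_def)
    obtain C where C: "\<And>z. norm z \<le> R \<Longrightarrow> \<bar>F z\<bar> \<le> C"
      using bounded_image_cball_obtain[OF bdd] by blast
    have key: "R * norm (\<eta> k) \<le> C + (blinfun_apply (\<eta> k) (y k) - f (y k))" for k
    proof (rule norm_dual_le_of_ball_bound[OF \<open>R > 0\<close>])
      fix z :: 'a assume "norm z \<le> R"
      have "f (y k) + blinfun_apply (\<eta> k) (z - y k) \<le> F z"
        using y \<eta> G F by (force simp: subdifferential_def)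
      with C[OF \<open>norm z \<le> R\<close>]
      show "blinfun_apply (\<eta> k) z \<le> C + (blinfun_apply (\<eta> k) (y k) - f (y k))"
        by (simp add: blinfun.diff_right)
    qed
    have "\<forall>\<^sub>F k in sequentially. \<bar>C\<bar> + 1 \<le> norm (\<eta> k)"
      using lim by (auto simp: filterlim_at_top)
    then show "\<forall>\<^sub>F k in sequentially. Z \<le> (blinfun_apply (\<eta> k) (y k) - f (y k)) / norm (\<eta> k)"
    proof eventually_elim
      case (elim k)
      then have p: "norm (\<eta> k) > 0" by linarith
      have "Z * norm (\<eta> k) \<le> (R - 1) * norm (\<eta> k)"
        using p by (intro mult_right_mono) (auto simp: R_def)
      also have "\<dots> \<le> blinfun_apply (\<eta> k) (y k) - f (y k)"
        using key[of k] elim by (simp add: algebra_simps)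
      finally show ?case using p by (simp add: le_divide_eq)
    qed
  qed
qed

lemma subdifferential_norm_bounded:
  fixes F :: "'a::real_normed_vector \<Rightarrow> real"
  assumes "\<forall>B. bounded B \<longrightarrow> bounded (F ` B)"
  obtains M where "\<And>\<xi>. \<xi> \<in> subdifferential F x \<Longrightarrow> norm \<xi> \<le> M"
proof -
  obtain C where C: "\<And>z. norm z \<le> norm x + 1 \<Longrightarrow> \<bar>F z\<bar> \<le> C"
    using bounded_image_cball_obtain[OF assms] by blast
  have "norm \<xi> \<le> C - F x" if "\<xi> \<in> subdifferential F x" for \<xi>
  proof -
    have "1 * norm \<xi> \<le> C - F x"
    proof (rule norm_dual_le_of_ball_bound)
      fix z :: 'a assume "norm z \<le> 1"
      then have "F (x + z) \<le> C"
        using C[of "x + z"] norm_triangle_ineq[of x z] by linarith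
      moreover have "F (x + z) \<ge> F x + blinfun_apply \<xi> (x + z - x)"
        using that unfolding subdifferential_def by blast
      ultimately show "blinfun_apply \<xi> z \<le> C - F x" by simp
    qed simp
    then show ?thesis by simp
  qed
  then show thesis by (rule that)
qed

text \<open>Bounded \<open>\<epsilon> k\<close>-subgradients at \<open>x\<close> approach the
  subdifferential: a subsequence staying away from it at finitely many points of \<open>D\<close>
  would have a weak-star cluster point, which is a subgradient. A diagonal choice then handles all
  points of \<open>D\<close>.\<close>

lemma subdifferential_approximation:
  fixes F :: "'a::real_normed_vector \<Rightarrow> real" and \<eta> :: "nat \<Rightarrow> 'a dual" and D :: "'a set"
  assumes D: "countable D" "closure D = UNIV"
    and bdd: "\<forall>B. bounded B \<longrightarrow> bounded (F ` B)"
    and ne: "subdifferential F x \<noteq> {}"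
    and M: "\<And>k. norm (\<eta> k) \<le> M"
    and eps: "\<And>k z. F z \<ge> F x + blinfun_apply (\<eta> k) (z - x) - \<epsilon> k" "\<epsilon> \<longlonglongrightarrow> 0"
  obtains \<xi> where "\<And>k. \<xi> k \<in> subdifferential F x"
    "limitin weak_star (\<lambda>k. \<eta> k - \<xi> k) 0 sequentially"
proof -
  have "D \<noteq> {}" using D(2) by auto
  then obtain d :: "nat \<Rightarrow> 'a" where d: "D = range d"
    using D(1) uncountable_def by blast
  \<comment> \<open>Some subgradient is \<open>1 / n\<close>-close to \<open>\<eta> k\<close> at the
    first \<open>n\<close> points of \<open>D\<close>. Level \<open>0\<close> is vacuous, so a
    greatest level up to \<open>k\<close> always exists.\<close>
  define P where "P k n \<longleftrightarrow> (\<exists>\<xi>\<in>subdifferential F x. \<forall>i<n.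
      \<bar>blinfun_apply (\<eta> k - \<xi>) (d i)\<bar> < 1 / real n)" for k n
  have P0: "P k 0" for k using ne by (auto simp: P_def)
  have ev: "\<forall>\<^sub>F k in sequentially. P k n" if "n > 0" for n
  proof (rule ccontr)
    assume "\<not> (\<forall>\<^sub>F k in sequentially. P k n)"
    then obtain r :: "nat \<Rightarrow> nat" where r: "strict_mono r" "\<And>k. \<not> P (r k) n"
      by (auto dest: not_eventually_sequentiallyD)
    obtain s \<xi> where s: "strict_mono (s :: nat \<Rightarrow> nat)"
      and lim: "\<And>z. (\<lambda>k. blinfun_apply (\<eta> (r (s k))) z) \<longlonglongrightarrow> blinfun_apply \<xi> z"
      using bounded_dual_convergent_subsequence[OF D, of "\<lambda>k. \<eta> (r k)" M] M by blast
    have "strict_mono (r \<circ> s)" using r(1) s by (rule strict_mono_o)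
    then have eps0: "(\<lambda>k. \<epsilon> (r (s k))) \<longlonglongrightarrow> 0"
      using LIMSEQ_subseq_LIMSEQ[OF eps(2)] by (simp add: o_def)
    \<comment> \<open>For fixed \<open>z\<close> the inequality with error \<open>\<epsilon>\<close>
      passes to the limit.\<close>
    have "F z \<ge> F x + blinfun_apply \<xi> (z - x)" for z
    proof -
      have "(\<lambda>k. F x + blinfun_apply (\<eta> (r (s k))) (z - x) - \<epsilon> (r (s k)))
          \<longlonglongrightarrow> F x + blinfun_apply \<xi> (z - x) - 0"
        by (intro tendsto_intros lim eps0)
      then show ?thesis
        using eps(1) by (auto intro: LIMSEQ_le_const2)
    qed
    then have \<xi>: "\<xi> \<in> subdifferential F x" by (simp add: subdifferential_def)
    have "\<forall>\<^sub>F k in sequentially. \<bar>blinfun_apply (\<eta> (r (s k)) - \<xi>) (d i)\<bar> < 1 / real n" for i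
      using tendstoD[OF lim[of "d i"], of "1 / real n"] \<open>n > 0\<close>
      by (simp add: dist_real_def blinfun.diff_left)
    then have "\<forall>\<^sub>F k in sequentially. \<forall>i\<in>{..<n}. \<bar>blinfun_apply (\<eta> (r (s k)) - \<xi>) (d i)\<bar> < 1 / real n"
      by (intro eventually_ball_finite) auto
    then obtain k where "\<forall>i\<in>{..<n}. \<bar>blinfun_apply (\<eta> (r (s k)) - \<xi>) (d i)\<bar> < 1 / real n"
      by (auto simp: eventually_sequentially)
    with \<xi> have "P (r (s k)) n" by (auto simp: P_def)
    with r(2) show False by blast
  qed
  \<comment> \<open>Diagonal choice: approximate at the best level that is available up to \<open>k\<close>.\<close>
  define n where "n k = (GREATEST m. m \<le> k \<and> P k m)" for k
  have nP: "P k (n k)" for k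
    using GreatestI_nat[of "\<lambda>m. m \<le> k \<and> P k m" 0 k] P0 by (simp add: n_def)
  have n_ge: "m \<le> n k" if "m \<le> k" "P k m" for m k
    using Greatest_le_nat[of "\<lambda>m. m \<le> k \<and> P k m" m k] that by (simp add: n_def)
  have n_lim: "\<forall>\<^sub>F k in sequentially. m \<le> n k" for m
  proof (cases "m = 0")
    case False
    then have "\<forall>\<^sub>F k in sequentially. P k m" by (intro ev) simp
    with eventually_ge_at_top[of m] show ?thesis
      by eventually_elim (rule n_ge)
  qed simp
  from nP obtain \<xi> where \<xi>: "\<And>k. \<xi> k \<in> subdifferential F x"
    and close: "\<And>k i. i < n k \<Longrightarrow> \<bar>blinfun_apply (\<eta> k - \<xi> k) (d i)\<bar> < 1 / real (n k)"
    unfolding P_def by metis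
  have dlim: "(\<lambda>k. blinfun_apply (\<eta> k - \<xi> k) (d i)) \<longlonglongrightarrow> 0" for i
  proof (rule tendstoI)
    fix e :: real assume "e > 0"
    then obtain m where m: "m > 0" "1 / real m < e"
      using nat_approx_posE[of e] by (metis zero_less_Suc)
    \<comment> \<open>Level \<open>Suc i\<close> puts \<open>d i\<close> among the tested points;
      level \<open>m\<close> brings the tolerance below \<open>e\<close>.\<close>
    show "\<forall>\<^sub>F k in sequentially. dist (blinfun_apply (\<eta> k - \<xi> k) (d i)) 0 < e"
      using n_lim[of "max m (Suc i)"]
    proof eventually_elim
      case (elim k)
      then have "1 / real (n k) \<le> 1 / real m" using m by (intro divide_left_mono) auto
      with close[of i k] elim m show ?case by (simp add: dist_real_def)
    qed
  qed
  \<comment> \<open>Boundedness of the differences carries their convergence from \<open>D\<close>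
    to the whole space; the limit functional vanishes on \<open>D\<close>, hence everywhere.\<close>
  obtain L where L: "\<And>\<xi>. \<xi> \<in> subdifferential F x \<Longrightarrow> norm \<xi> \<le> L"
    using subdifferential_norm_bounded[OF bdd] by blast
  have "norm (\<eta> k - \<xi> k) \<le> M + L" for k
    using norm_triangle_ineq4[of "\<eta> k" "\<xi> k"] M[of k] L[OF \<xi>[of k]] by linarith
  moreover have "convergent (\<lambda>k. blinfun_apply (\<eta> k - \<xi> k) z)" if "z \<in> D" for z
    using that dlim by (auto simp: d convergent_def)
  ultimately obtain \<zeta> where \<zeta>: "\<And>z. (\<lambda>k. blinfun_apply (\<eta> k - \<xi> k) z) \<longlonglongrightarrow> blinfun_apply \<zeta> z"
    using bounded_dual_tendsto_dense[OF D(2), of "\<lambda>k. \<eta> k - \<xi> k" "M + L"] by blast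
  have "closure D \<subseteq> {z. blinfun_apply \<zeta> z = 0}"
  proof (rule closure_minimal)
    show "D \<subseteq> {z. blinfun_apply \<zeta> z = 0}"
      using LIMSEQ_unique[OF \<zeta> dlim] by (auto simp: d)
    show "closed {z. blinfun_apply \<zeta> z = 0}"
      by (intro closed_Collect_eq continuous_intros)
  qed
  then have "\<zeta> = 0" using D(2) by (auto intro!: blinfun_eqI)
  with \<zeta> have "limitin weak_star (\<lambda>k. \<eta> k - \<xi> k) 0 sequentially"
    by (simp add: limitin_weak_star_iff)
  with \<xi> that show thesis by blast
qed

text \<open>A subgradient at \<open>y k\<close> is an \<open>\<epsilon>\<close>-subgradient at
  \<open>x\<close>, where \<open>\<epsilon>\<close> is exactly the expression assumed to tend to
  zero.\<close>

lemma condition_SCS_of_subdifferential: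
  fixes F :: "'a::real_normed_vector \<Rightarrow> real"
  assumes sep: "separable_space (euclidean :: 'a topology)"
    and bdd: "\<forall>B. bounded B \<longrightarrow> bounded (F ` B)"
    and F: "\<And>x. x \<in> E \<Longrightarrow> F x = f x" and G: "\<And>x. x \<in> E \<Longrightarrow> G x = subdifferential F x"
    and ne: "\<And>x. x \<in> E \<Longrightarrow> G x \<noteq> {}"
  shows "condition_SCS E f G"
  unfolding condition_SCS_def
proof (intro ballI allI impI, elim conjE)
  fix x and y :: "nat \<Rightarrow> 'a" and \<eta> :: "nat \<Rightarrow> 'a dual"
  assume x: "x \<in> E" and y: "\<forall>k. y k \<in> E" and \<eta>: "\<forall>k. \<eta> k \<in> G (y k)"
    and "bounded (range \<eta>)"
    and lim: "(\<lambda>k. f x - f (y k) - blinfun_apply (\<eta> k) (x - y k)) \<longlonglongrightarrow> 0"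
  then obtain M where M: "\<And>k. norm (\<eta> k) \<le> M" by (auto simp: bounded_iff)
  obtain D :: "'a set" where D: "countable D" "closure D = UNIV"
    using sep by (auto simp: separable_space_def)
  have "F z \<ge> F x + blinfun_apply (\<eta> k) (z - x) - (f x - f (y k) - blinfun_apply (\<eta> k) (x - y k))"
    for k z
  proof -
    have "F z \<ge> F (y k) + blinfun_apply (\<eta> k) (z - y k)"
      using y \<eta> G by (force simp: subdifferential_def)
    then show ?thesis using F x y by (simp add: blinfun.diff_right)
  qed
  from subdifferential_approximation[OF D bdd _ M this lim] ne[OF x] G[OF x]
  show "\<exists>\<xi>. (\<forall>k. \<xi> k \<in> G x) \<and> limitin weak_star (\<lambda>k. \<eta> k - \<xi> k) 0 sequentially"
    by metis
qed

section \<open>Sufficiency: slope bounds and the minimal extension\<close>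

text \<open>Minorants with values at least \<open>L\<close> on the ball satisfy
  \<open>\<eta> y - f y \<le> R * norm \<eta> + \<bar>L\<bar>\<close>, which keeps the quotient in
  \<open>condition_EX\<close> bounded along a sequence of slopes of norm greater than 1.\<close>

lemma condition_EX_norm_bound:
  fixes E :: "'a::real_normed_vector set"
  assumes EX: "condition_EX E f G"
  obtains M where "\<And>y \<eta> z. \<lbrakk>y \<in> E; \<eta> \<in> G y; norm z \<le> R; f y + blinfun_apply \<eta> (z - y) \<ge> L\<rbrakk> \<Longrightarrow> norm \<eta> \<le> M"
proof -
  have "\<exists>M. \<forall>y \<eta> z. y \<in> E \<longrightarrow> \<eta> \<in> G y \<longrightarrow> norm z \<le> R \<longrightarrow> f y + blinfun_apply \<eta> (z - y) \<ge> L \<longrightarrow> norm \<eta> \<le> M"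
  proof (rule ccontr)
    assume "\<not> ?thesis"
    then have "\<forall>k::nat. \<exists>y \<eta> z. y \<in> E \<and> \<eta> \<in> G y \<and> norm z \<le> R \<and> f y + blinfun_apply \<eta> (z - y) \<ge> L \<and> norm \<eta> > real k"
      by (meson not_le)
    then obtain y \<eta> z where *: "\<And>k::nat. y k \<in> E" "\<And>k. \<eta> k \<in> G (y k)" "\<And>k. norm (z k) \<le> R"
        "\<And>k. f (y k) + blinfun_apply (\<eta> k) (z k - y k) \<ge> L" "\<And>k. norm (\<eta> k) > real k"
      by metis
    have "filterlim (\<lambda>k. norm (\<eta> k)) at_top sequentially"
      by (rule filterlim_at_top_mono[OF filterlim_real_sequentially])
        (intro always_eventually allI less_imp_le *(5))
    then have "filterlim (\<lambda>k. (blinfun_apply (\<eta> k) (y k) - f (y k)) / norm (\<eta> k)) at_top sequentially"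
      using EX *(1,2) unfolding condition_EX_def by blast
    \<comment> \<open>This threshold leads to
      \<open>(\<bar>L\<bar> + 1) * norm (\<eta> k) \<le> \<bar>L\<bar>\<close>, impossible once the
      norm exceeds 1.\<close>
    then have "\<forall>\<^sub>F k in sequentially. R + \<bar>L\<bar> + 1 \<le> (blinfun_apply (\<eta> k) (y k) - f (y k)) / norm (\<eta> k)"
      by (auto simp: filterlim_at_top)
    then have "\<forall>\<^sub>F k in sequentially. False"
      using eventually_ge_at_top[of 1]
    proof eventually_elim
      case (elim k)
      then have n1: "norm (\<eta> k) > 1" using *(5)[of k] by linarith
      have "(R + \<bar>L\<bar> + 1) * norm (\<eta> k) \<le> blinfun_apply (\<eta> k) (y k) - f (y k)"
        using elim(1) n1 by (subst (asm) pos_le_divide_eq) auto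
      also have "\<dots> \<le> blinfun_apply (\<eta> k) (z k) - L"
        using *(4)[of k] by (simp add: blinfun.diff_right)
      also have "\<dots> \<le> R * norm (\<eta> k) + \<bar>L\<bar>"
        using norm_blinfun[of "\<eta> k" "z k"] mult_left_mono[OF *(3)[of k] norm_ge_zero[of "\<eta> k"]]
        by (simp add: mult.commute)
      finally have "(\<bar>L\<bar> + 1) * norm (\<eta> k) \<le> \<bar>L\<bar>" by (simp add: algebra_simps)
      moreover have "(\<bar>L\<bar> + 1) * 1 \<le> (\<bar>L\<bar> + 1) * norm (\<eta> k)"
        using n1 by (intro mult_left_mono) auto
      ultimately have "(\<bar>L\<bar> + 1) * 1 \<le> \<bar>L\<bar>" by (rule order_trans[rotated])
      then show False by simp
    qed
    then show False by simp
  qed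
  with that show thesis by blast
qed

text \<open>Any function that agrees with \<open>f\<close> on \<open>E\<close> and has the elements
  of \<open>G y\<close> as subgradients at each \<open>y\<close> in \<open>E\<close> dominates all
  these affine functions, hence the name. The real supremum is meaningful only for a nonempty family
  bounded above.\<close>

definition minimal_extension ::
    "'a::real_normed_vector set \<Rightarrow> ('a \<Rightarrow> real) \<Rightarrow> ('a \<Rightarrow> 'a dual set) \<Rightarrow> 'a \<Rightarrow> real" where
  "minimal_extension E f G z = (SUP (y, \<eta>)\<in>Sigma E G. f y + blinfun_apply \<eta> (z - y))"

context
  fixes E :: "'a::real_normed_vector set" and f :: "'a \<Rightarrow> real" and G :: "'a \<Rightarrow> 'a dual set"
  assumes nonempty: "E \<noteq> {}" "\<And>x. x \<in> E \<Longrightarrow> G x \<noteq> {}"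
    and C: "condition_C E f G" and EX: "condition_EX E f G"
begin

text \<open>A minorant negative at \<open>z\<close> is harmless. Otherwise \<open>EX\<close> bounds
  its slope and \<open>C\<close> bounds its value at a fixed point \<open>x\<close> of
  \<open>E\<close>, so its value at \<open>z\<close> is controlled.\<close>

lemma affine_minorants_bound:
  obtains B where "\<And>y \<eta> z. y \<in> E \<Longrightarrow> \<eta> \<in> G y \<Longrightarrow> norm z \<le> R \<Longrightarrow> f y + blinfun_apply \<eta> (z - y) \<le> B"
proof -
  obtain x where x: "x \<in> E" using nonempty by blast
  obtain M where M: "\<And>y \<eta> z. \<lbrakk>y \<in> E; \<eta> \<in> G y; norm z \<le> R; f y + blinfun_apply \<eta> (z - y) \<ge> 0\<rbrakk> \<Longrightarrow> norm \<eta> \<le> M"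
    using condition_EX_norm_bound[OF EX] by blast
  have "f y + blinfun_apply \<eta> (z - y) \<le> max 0 (f x + \<bar>M\<bar> * (R + norm x))"
    if "y \<in> E" "\<eta> \<in> G y" "norm z \<le> R" for y \<eta> z
  proof (cases "f y + blinfun_apply \<eta> (z - y) \<ge> 0")
    case True
    have "f y + blinfun_apply \<eta> (x - y) \<le> f x"
      using C x that by (auto simp: condition_C_def)
    moreover have "blinfun_apply \<eta> (z - x) \<le> \<bar>M\<bar> * (R + norm x)"
    proof -
      have "blinfun_apply \<eta> (z - x) \<le> norm \<eta> * norm (z - x)"
        using norm_blinfun[of \<eta> "z - x"] by simp
      also have "\<dots> \<le> \<bar>M\<bar> * (R + norm x)"
        using M[OF that True] that(3) norm_triangle_ineq4[of z x] by (intro mult_mono) auto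
      finally show ?thesis .
    qed
    ultimately show ?thesis by (simp add: blinfun.diff_right)
  qed simp
  then show thesis by (rule that)
qed

lemma minimal_extension_ge:
  assumes "y \<in> E" "\<eta> \<in> G y"
  shows "f y + blinfun_apply \<eta> (z - y) \<le> minimal_extension E f G z"
proof -
  obtain B where B: "\<And>y \<eta> w. y \<in> E \<Longrightarrow> \<eta> \<in> G y \<Longrightarrow> norm w \<le> norm z \<Longrightarrow> f y + blinfun_apply \<eta> (w - y) \<le> B"
    using affine_minorants_bound by blast
  have "bdd_above ((\<lambda>(y, \<eta>). f y + blinfun_apply \<eta> (z - y)) ` Sigma E G)"
    using B by (intro bdd_aboveI[of _ B]) auto
  then show ?thesis
    unfolding minimal_extension_def using assms
    by (intro cSUP_upper2[where x = "(y, \<eta>)"]) auto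
qed

lemma minimal_extension_le:
  assumes "\<And>y \<eta>. y \<in> E \<Longrightarrow> \<eta> \<in> G y \<Longrightarrow> f y + blinfun_apply \<eta> (z - y) \<le> c"
  shows "minimal_extension E f G z \<le> c"
proof -
  have "Sigma E G \<noteq> {}" using nonempty by fastforce
  then show ?thesis unfolding minimal_extension_def using assms by (intro cSUP_least) auto
qed

text \<open>By \<open>C\<close> every minorant lies below \<open>f x\<close> at \<open>x\<close>,
  and those based at \<open>x\<close> attain it.\<close>

lemma minimal_extension_eq: "x \<in> E \<Longrightarrow> minimal_extension E f G x = f x"
proof (rule antisym)
  assume x: "x \<in> E"
  then show "minimal_extension E f G x \<le> f x"
    using C by (intro minimal_extension_le) (auto simp: condition_C_def)
  obtain \<eta> where "\<eta> \<in> G x" using nonempty x by blast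
  from minimal_extension_ge[OF x this, of x] show "f x \<le> minimal_extension E f G x" by simp
qed

lemma convex_minimal_extension: "convex_on UNIV (minimal_extension E f G)"
proof (rule convex_onI)
  fix t :: real and u v :: 'a assume t: "t > 0" "t < 1"
  let ?m = "minimal_extension E f G"
  show "?m ((1 - t) *\<^sub>R u + t *\<^sub>R v) \<le> (1 - t) * ?m u + t * ?m v"
  proof (rule minimal_extension_le)
    fix y \<eta> assume y: "y \<in> E" "\<eta> \<in> G y"
    have "f y + blinfun_apply \<eta> ((1 - t) *\<^sub>R u + t *\<^sub>R v - y)
        = (1 - t) * (f y + blinfun_apply \<eta> (u - y)) + t * (f y + blinfun_apply \<eta> (v - y))"
      by (simp add: blinfun.diff_right blinfun.add_right blinfun.scaleR_right algebra_simps)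
    also have "\<dots> \<le> (1 - t) * ?m u + t * ?m v"
      using t by (intro add_mono mult_left_mono minimal_extension_ge y) auto
    finally show "f y + blinfun_apply \<eta> ((1 - t) *\<^sub>R u + t *\<^sub>R v - y) \<le> \<dots>" .
  qed
qed simp

lemma bounded_minimal_extension:
  assumes "bounded B"
  shows "bounded (minimal_extension E f G ` B)"
proof -
  obtain R where R: "\<And>z. z \<in> B \<Longrightarrow> norm z \<le> R" using assms by (auto simp: bounded_iff)
  obtain A where A: "\<And>y \<eta> z. y \<in> E \<Longrightarrow> \<eta> \<in> G y \<Longrightarrow> norm z \<le> R \<Longrightarrow> f y + blinfun_apply \<eta> (z - y) \<le> A"
    using affine_minorants_bound by blast
  \<comment> \<open>One minorant already gives the lower bound.\<close>
  obtain y \<eta> where y: "y \<in> E" "\<eta> \<in> G y" using nonempty by blast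
  have "minimal_extension E f G z \<in> {f y - blinfun_apply \<eta> y - norm \<eta> * R..A}" if "z \<in> B" for z
  proof -
    have "\<bar>blinfun_apply \<eta> z\<bar> \<le> norm \<eta> * R"
      using norm_blinfun[of \<eta> z] mult_left_mono[OF R[OF that] norm_ge_zero[of \<eta>]] by simp
    with minimal_extension_ge[OF y, of z] minimal_extension_le[of z A] A R[OF that]
    show ?thesis by (force simp: blinfun.diff_right)
  qed
  then have "minimal_extension E f G ` B \<subseteq> {f y - blinfun_apply \<eta> y - norm \<eta> * R..A}" by blast
  then show ?thesis by (rule bounded_subset[OF bounded_closed_interval])
qed

section \<open>The subdifferential of the minimal extension at points of \<open>E\<close>\<close>

lemma subdifferential_minimal_extension_subset:
  assumes SCS: "condition_SCS E f G" and x: "x \<in> E"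
    and Gx: "convex (G x)" "compactin weak_star (G x)"
  shows "subdifferential (minimal_extension E f G) x \<subseteq> G x"
proof (rule subsetI, rule ccontr)
  let ?m = "minimal_extension E f G"
  fix \<xi> assume \<xi>: "\<xi> \<in> subdifferential ?m x" and "\<xi> \<notin> G x"
  then obtain v d where d: "d > 0"
    and sep: "\<And>\<eta>. \<eta> \<in> G x \<Longrightarrow> blinfun_apply \<eta> v + d \<le> blinfun_apply \<xi> v"
    using weak_star_separation[OF Gx(2,1) nonempty(2)[OF x]] by metis
  define t where "t k = 1 / real (Suc k)" for k
  have t: "t k > 0" "t k \<le> 1" for k by (auto simp: t_def)
  have t0: "t \<longlonglongrightarrow> 0" unfolding t_def using LIMSEQ_Suc[OF lim_1_over_n] by simp
  have m_ge: "?m (x + t k *\<^sub>R v) \<ge> f x + t k * blinfun_apply \<xi> v" for k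
  proof -
    have "?m (x + t k *\<^sub>R v) \<ge> ?m x + blinfun_apply \<xi> (x + t k *\<^sub>R v - x)"
      using \<xi> unfolding subdifferential_def by blast
    then show ?thesis by (simp add: minimal_extension_eq[OF x] blinfun.scaleR_right)
  qed
  \<comment> \<open>The error \<open>(t k)\<^sup>2\<close> is of smaller order than the step
    \<open>t k\<close>, so it still vanishes after division by \<open>t k\<close>.\<close>
  have "\<exists>y \<eta>. y \<in> E \<and> \<eta> \<in> G y \<and>
      ?m (x + t k *\<^sub>R v) - (t k)\<^sup>2 < f y + blinfun_apply \<eta> (x + t k *\<^sub>R v - y)" for k
  proof (rule ccontr)
    assume "\<not> ?thesis"
    then have "?m (x + t k *\<^sub>R v) \<le> ?m (x + t k *\<^sub>R v) - (t k)\<^sup>2"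
      by (intro minimal_extension_le) (meson not_less)
    moreover have "(t k)\<^sup>2 > 0" using t(1)[of k] by simp
    ultimately show False by linarith
  qed
  then obtain y \<eta> where y: "\<And>k. y k \<in> E" "\<And>k. \<eta> k \<in> G (y k)"
    and "\<And>k. ?m (x + t k *\<^sub>R v) - (t k)\<^sup>2 < f (y k) + blinfun_apply (\<eta> k) (x + t k *\<^sub>R v - y k)"
    by metis
  then have near: "f x + t k * blinfun_apply \<xi> v - (t k)\<^sup>2
      \<le> f (y k) + blinfun_apply (\<eta> k) (x + t k *\<^sub>R v - y k)" for k
    using m_ge[of k] by (meson diff_right_mono less_imp_le order_trans)
  \<comment> \<open>The threshold lies below the values of the chosen minorants at
    \<open>x + t k *\<^sub>R v\<close>, since \<open>t k \<le> 1\<close>. Their slopes are thus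
    bounded, as \<open>SCS\<close> demands.\<close>
  obtain M where M: "\<And>y \<eta> z. \<lbrakk>y \<in> E; \<eta> \<in> G y; norm z \<le> norm x + norm v;
      f y + blinfun_apply \<eta> (z - y) \<ge> f x - \<bar>blinfun_apply \<xi> v\<bar> - 1\<rbrakk> \<Longrightarrow> norm \<eta> \<le> M"
    using condition_EX_norm_bound[OF EX] by blast
  have t_xi: "\<bar>t k * a\<bar> \<le> \<bar>a\<bar>" for k a
    using mult_right_mono[OF t(2)[of k] abs_ge_zero[of a]] t(1)[of k] by (simp add: abs_mult)
  have \<eta>M: "norm (\<eta> k) \<le> M" for k
  proof (rule M[OF y])
    show "norm (x + t k *\<^sub>R v) \<le> norm x + norm v"
      using norm_triangle_ineq[of x "t k *\<^sub>R v"] t_xi[of k "norm v"] t(1)[of k] by simp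
    have "(t k)\<^sup>2 \<le> 1" using t(1,2)[of k] by (simp add: power_le_one)
    then show "f (y k) + blinfun_apply (\<eta> k) (x + t k *\<^sub>R v - y k) \<ge> f x - \<bar>blinfun_apply \<xi> v\<bar> - 1"
      using near[of k] t_xi[of k "blinfun_apply \<xi> v"] by linarith
  qed
  \<comment> \<open>Nonnegative by \<open>C\<close> and at most \<open>t k\<close> times a bounded
    factor. It tends to zero, so \<open>SCS\<close> applies; its sign forces that factor to be
    nonnegative, which bounds \<open>\<eta> k\<close> along \<open>v\<close> from below.\<close>
  define gap where "gap k = f x - f (y k) - blinfun_apply (\<eta> k) (x - y k)" for k
  have gap0: "gap k \<ge> 0" for k
    using C x y[of k] unfolding condition_C_def gap_def by force
  have gap: "gap k \<le> t k * (blinfun_apply (\<eta> k) v - blinfun_apply \<xi> v + t k)" for k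
    using near[of k]
    by (simp add: gap_def blinfun.diff_right blinfun.add_right blinfun.scaleR_right
        power2_eq_square algebra_simps)
  have "gap \<longlonglongrightarrow> 0"
  proof (rule tendsto_sandwich[OF _ _ tendsto_const])
    show "\<forall>\<^sub>F k in sequentially. 0 \<le> gap k" using gap0 by simp
    have "blinfun_apply (\<eta> k) v \<le> M * norm v" for k
      using norm_blinfun[of "\<eta> k" v] mult_right_mono[OF \<eta>M[of k] norm_ge_zero[of v]] by simp
    then have "gap k \<le> t k * (M * norm v - blinfun_apply \<xi> v + t k)" for k
      using t(1)[of k] by (intro order_trans[OF gap] mult_left_mono) auto
    then show "\<forall>\<^sub>F k in sequentially. gap k \<le> t k * (M * norm v - blinfun_apply \<xi> v + t k)" by simp
    have "(\<lambda>k. t k * (M * norm v - blinfun_apply \<xi> v + t k)) \<longlonglongrightarrow> 0 * (M * norm v - blinfun_apply \<xi> v + 0)"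
      by (intro tendsto_intros t0)
    then show "(\<lambda>k. t k * (M * norm v - blinfun_apply \<xi> v + t k)) \<longlonglongrightarrow> 0" by simp
  qed
  moreover have "bounded (range \<eta>)" using \<eta>M by (auto simp: bounded_iff)
  ultimately obtain \<zeta> where \<zeta>: "\<And>k. \<zeta> k \<in> G x"
    and lim: "limitin weak_star (\<lambda>k. \<eta> k - \<zeta> k) 0 sequentially"
    using SCS x y unfolding condition_SCS_def gap_def by meson
  from lim have "(\<lambda>k. blinfun_apply (\<eta> k - \<zeta> k) v) \<longlonglongrightarrow> 0"
    by (simp add: limitin_weak_star_iff)
  from tendsto_add[OF this t0] have "(\<lambda>k. blinfun_apply (\<eta> k - \<zeta> k) v + t k) \<longlonglongrightarrow> 0" by simp
  \<comment> \<open>The slope of \<open>\<eta> k\<close> along \<open>v\<close> is at least that of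
    \<open>\<xi>\<close> up to \<open>t k\<close>, whereas \<open>\<zeta> k\<close> stays below
    \<open>\<xi>\<close> by \<open>d\<close>.\<close>
  moreover have "d \<le> blinfun_apply (\<eta> k - \<zeta> k) v + t k" for k
  proof -
    have "0 \<le> t k * (blinfun_apply (\<eta> k) v - blinfun_apply \<xi> v + t k)"
      using gap0[of k] gap[of k] by linarith
    then have "0 \<le> blinfun_apply (\<eta> k) v - blinfun_apply \<xi> v + t k"
      using t(1)[of k] by (simp add: zero_le_mult_iff)
    with sep[OF \<zeta>[of k]] show ?thesis by (simp add: blinfun.diff_left)
  qed
  ultimately have "d \<le> 0" by (meson LIMSEQ_le_const)
  with d show False by simp
qed

text \<open>The remaining inclusion holds because the minorants based at \<open>x\<close> touch the
  extension there.\<close>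

lemma subdifferential_minimal_extension:
  assumes "condition_SCS E f G" and x: "x \<in> E"
    and "convex (G x)" "compactin weak_star (G x)"
  shows "subdifferential (minimal_extension E f G) x = G x"
  using subdifferential_minimal_extension_subset[OF assms] minimal_extension_ge[OF x]
  by (auto simp: subdifferential_def minimal_extension_eq[OF x])

end

section \<open>Both implications combined, with empty \<open>E\<close> treated apart\<close>

theorem theorem1p4:
  fixes E :: "'a::banach set"
    and f :: "'a \<Rightarrow> real"
    and G :: "'a \<Rightarrow> 'a dual set"
  assumes "separable_space (euclidean :: 'a topology)"
    and "\<And>x. x \<in> E \<Longrightarrow> G x \<noteq> {}"
    and "\<And>x. x \<in> E \<Longrightarrow> convex (G x)"
    and "\<And>x. x \<in> E \<Longrightarrow> compactin weak_star (G x)"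
  shows "(\<exists>F :: 'a \<Rightarrow> real. convex_on UNIV F \<and>
            (\<forall>B. bounded B \<longrightarrow> bounded (F ` B)) \<and>
            (\<forall>x\<in>E. F x = f x \<and> subdifferential F x = G x))
    \<longleftrightarrow> condition_C E f G \<and> condition_EX E f G \<and> condition_SCS E f G"
proof
  assume "\<exists>F :: 'a \<Rightarrow> real. convex_on UNIV F \<and>
            (\<forall>B. bounded B \<longrightarrow> bounded (F ` B)) \<and>
            (\<forall>x\<in>E. F x = f x \<and> subdifferential F x = G x)"
  then obtain F :: "'a \<Rightarrow> real" where bdd: "\<forall>B. bounded B \<longrightarrow> bounded (F ` B)"
    and F: "\<And>x. x \<in> E \<Longrightarrow> F x = f x" and G: "\<And>x. x \<in> E \<Longrightarrow> G x = subdifferential F x"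
    by blast
  have "condition_C E f G"
    unfolding condition_C_def
  proof (intro ballI)
    fix x y \<eta> assume "x \<in> E" "y \<in> E" "\<eta> \<in> G y"
    then show "f x \<ge> f y + blinfun_apply \<eta> (x - y)"
      using F G[of y] by (simp add: subdifferential_def) metis
  qed
  moreover have "condition_EX E f G"
    using condition_EX_of_subdifferential[OF bdd F] G by blast
  moreover have "condition_SCS E f G"
    using condition_SCS_of_subdifferential[OF assms(1) bdd F G assms(2)] by blast
  ultimately show "condition_C E f G \<and> condition_EX E f G \<and> condition_SCS E f G" by blast
next
  assume cond: "condition_C E f G \<and> condition_EX E f G \<and> condition_SCS E f G"
  show "\<exists>F :: 'a \<Rightarrow> real. convex_on UNIV F \<and>
            (\<forall>B. bounded B \<longrightarrow> bounded (F ` B)) \<and>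
            (\<forall>x\<in>E. F x = f x \<and> subdifferential F x = G x)"
  proof (cases "E = {}")
    \<comment> \<open>The supremum would run over an empty family; the zero function serves instead,
      as nothing is prescribed on \<open>E\<close>.\<close>
    case True
    have "convex_on UNIV (\<lambda>x::'a. 0)" by (simp add: convex_on_const)
    moreover have "bounded ((\<lambda>x::'a. 0::real) ` B)" for B
      by (rule bounded_subset[of "{0}"]) auto
    ultimately show ?thesis using True by blast
  next
    case False
    note * = False assms(2) cond[THEN conjunct1] cond[THEN conjunct2, THEN conjunct1]
    show ?thesis
      using convex_minimal_extension[OF *] bounded_minimal_extension[OF *] minimal_extension_eq[OF *]
        subdifferential_minimal_extension[OF * _ _ assms(3,4)] cond
      by (intro exI[of _ "minimal_extension E f G"]) blast
  qed
qed

end
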